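(* Let $N_{2,3}$ be the $2$-generated free nilpotent group of nilpotency class $3$. There is an inner automorphism $\varphi$ of $N_{2,3}$ such that the twisted conjugacy class $[e]_{\varphi}$ of the unit element is not a subgroup of $N_{2,3}$.
   Context: For an automorphism $\varphi$ of a group $G$, $[e]_{\varphi}=\{z^{-1}z^{\varphi}\mid z\in G\}$ is the twisted conjugacy class of the unit element $e$, where $z^\varphi$ is the image of $z$ under $\varphi$. *)

theory Defs
  imports "HOL-Algebra.Bij" "HOL-Algebra.Generated_Groups"
begin

section \<open>Free groups\<close>

text \<open>
  The letter \<open>(True, x)\<close> stands for the generator \<open>x\<close>, the letter \<open>(False, x)\<close> for its formal
  inverse. The free group on \<open>X\<close> consists of the reduced words over these letters; the product is
  concatenation followed by reduction.
\<close>

type_synonym 'a letter = "bool \<times> 'a"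

definition inv_letter :: "'a letter \<Rightarrow> 'a letter" where
  "inv_letter l = (\<not> fst l, snd l)"

fun reduced :: "'a letter list \<Rightarrow> bool" where
  "reduced (k # l # w) \<longleftrightarrow> l \<noteq> inv_letter k \<and> reduced (l # w)"
| "reduced _ \<longleftrightarrow> True"

fun cancel_Cons :: "'a letter \<Rightarrow> 'a letter list \<Rightarrow> 'a letter list" where
  "cancel_Cons k [] = [k]"
| "cancel_Cons k (l # w) = (if l = inv_letter k then w else k # l # w)"

definition free_group :: "'a set \<Rightarrow> 'a letter list monoid" where
  "free_group X =
     \<lparr>carrier = {w. reduced w \<and> snd ` set w \<subseteq> X},
      mult = (\<lambda>v w. foldr cancel_Cons v w),
      one = []\<rparr>"

lemma inv_letter_inv_letter [simp]: "inv_letter (inv_letter k) = k"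
  by (simp add: inv_letter_def)

lemma inv_letter_neq [simp]: "inv_letter k \<noteq> k" "k \<noteq> inv_letter k"
  by (auto simp: inv_letter_def prod_eq_iff)

lemma snd_inv_letter [simp]: "snd (inv_letter k) = snd k"
  by (simp add: inv_letter_def)

lemma reduced_ConsD: "reduced (k # w) \<Longrightarrow> reduced w"
  by (cases w) auto

lemma reduced_cancel_Cons: "reduced w \<Longrightarrow> reduced (cancel_Cons k w)"
  by (cases w) (auto dest: reduced_ConsD)

lemma reduced_foldr_cancel_Cons: "reduced w \<Longrightarrow> reduced (foldr cancel_Cons v w)"
  by (induction v) (auto intro: reduced_cancel_Cons)

lemma cancel_Cons_inv_letter:
  "reduced w \<Longrightarrow> cancel_Cons k (cancel_Cons (inv_letter k) w) = w"
  by (cases w rule: reduced.cases) auto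

lemma foldr_cancel_Cons_cancel_Cons:
  assumes "reduced w"
  shows "foldr cancel_Cons (cancel_Cons k v) w = cancel_Cons k (foldr cancel_Cons v w)"
  using assms by (cases v) (auto simp: cancel_Cons_inv_letter reduced_foldr_cancel_Cons)

lemma foldr_cancel_Cons_assoc:
  assumes "reduced w"
  shows "foldr cancel_Cons (foldr cancel_Cons u v) w = foldr cancel_Cons u (foldr cancel_Cons v w)"
  using assms by (induction u) (auto simp: foldr_cancel_Cons_cancel_Cons)

lemma letters_cancel_Cons: "snd ` set (cancel_Cons k w) \<subseteq> insert (snd k) (snd ` set w)"
  by (cases w) auto

lemma letters_foldr_cancel_Cons:
  "snd ` set (foldr cancel_Cons v w) \<subseteq> snd ` set v \<union> snd ` set w"
proof (induction v)
  case (Cons k v)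
  then show ?case using letters_cancel_Cons[of k "foldr cancel_Cons v w"]
    by (simp only: foldr.simps o_apply list.set image_insert) blast
qed simp

lemma foldr_cancel_Cons_Nil: "reduced w \<Longrightarrow> foldr cancel_Cons w [] = w"
proof (induction w)
  case (Cons k w)
  then have "foldr cancel_Cons w [] = w" by (blast dest: reduced_ConsD)
  with Cons.prems show ?case by (cases w) auto
qed simp

lemma foldr_cancel_Cons_inverse:
  "reduced u \<Longrightarrow> foldr cancel_Cons (map inv_letter (rev w)) (foldr cancel_Cons w u) = u"
proof (induction w arbitrary: u)
  case (Cons k w)
  then show ?case
    using cancel_Cons_inv_letter[of "foldr cancel_Cons w u" "inv_letter k"]
    by (simp add: reduced_foldr_cancel_Cons)
qed simp

lemma group_free_group: "group (free_group X)"
proof (rule groupI)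
  fix w assume w: "w \<in> carrier (free_group X)"
  define v where "v = foldr cancel_Cons (map inv_letter (rev w)) []"
  have "v \<in> carrier (free_group X)"
    using w letters_foldr_cancel_Cons[of "map inv_letter (rev w)" "[]"]
    by (auto simp: v_def free_group_def reduced_foldr_cancel_Cons image_image)
  moreover have "v \<otimes>\<^bsub>free_group X\<^esub> w = foldr cancel_Cons (map inv_letter (rev w)) (foldr cancel_Cons w [])"
    using w by (simp add: v_def free_group_def foldr_cancel_Cons_assoc foldr_cancel_Cons_Nil)
  ultimately show "\<exists>v\<in>carrier (free_group X). v \<otimes>\<^bsub>free_group X\<^esub> w = \<one>\<^bsub>free_group X\<^esub>"
    by (intro bexI[of _ v]) (simp_all add: foldr_cancel_Cons_inverse, simp add: free_group_def)
next
  fix v w assume "v \<in> carrier (free_group X)" "w \<in> carrier (free_group X)"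
  then show "v \<otimes>\<^bsub>free_group X\<^esub> w \<in> carrier (free_group X)"
    using subset_trans[OF letters_foldr_cancel_Cons[of v w], of X]
    by (simp add: free_group_def reduced_foldr_cancel_Cons)
qed (auto simp: free_group_def foldr_cancel_Cons_assoc)


section \<open>Lower central series and free nilpotent groups\<close>

definition commutator_subgroup :: "('a, 'b) monoid_scheme \<Rightarrow> 'a set \<Rightarrow> 'a set \<Rightarrow> 'a set" where
  "commutator_subgroup G H K =
     generate G {inv\<^bsub>G\<^esub> h \<otimes>\<^bsub>G\<^esub> inv\<^bsub>G\<^esub> k \<otimes>\<^bsub>G\<^esub> h \<otimes>\<^bsub>G\<^esub> k |h k. h \<in> H \<and> k \<in> K}"

text \<open>
  The index is shifted with respect to the usual numbering \<open>\<gamma>\<^sub>1(G) = G\<close>: the set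
  \<open>lower_central G c\<close> is \<open>\<gamma>\<close> with index \<open>c + 1\<close>, and \<open>G\<close> is nilpotent of class at most \<open>c\<close> iff it is
  trivial.
\<close>

primrec lower_central :: "('a, 'b) monoid_scheme \<Rightarrow> nat \<Rightarrow> 'a set" where
  "lower_central G 0 = carrier G"
| "lower_central G (Suc c) = commutator_subgroup G (lower_central G c) (carrier G)"

definition free_nilpotent_group :: "nat \<Rightarrow> nat \<Rightarrow> nat letter list set monoid" where
  "free_nilpotent_group r c =
     free_group {..<r} Mod lower_central (free_group {..<r}) c"

lemma (in group) normal_commutator_subgroup:
  assumes "H \<lhd> G" and "K \<lhd> G"
  shows "commutator_subgroup G H K \<lhd> G"
  unfolding commutator_subgroup_def
proof (rule normal_generateI)
  interpret H: normal H G by fact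
  interpret K: normal K G by fact
  show "{inv h \<otimes> inv k \<otimes> h \<otimes> k |h k. h \<in> H \<and> k \<in> K} \<subseteq> carrier G" by auto
  fix x g
  assume "x \<in> {inv h \<otimes> inv k \<otimes> h \<otimes> k |h k. h \<in> H \<and> k \<in> K}" and g: "g \<in> carrier G"
  then obtain h k where x: "x = inv h \<otimes> inv k \<otimes> h \<otimes> k" and hk: "h \<in> H" "k \<in> K" by auto
  have in_carrier: "h \<in> carrier G" "k \<in> carrier G" using hk by auto
  have cancel: "inv g \<otimes> (g \<otimes> y) = y" if "y \<in> carrier G" for y
    using that g by (simp add: m_assoc[symmetric])
  let ?h = "g \<otimes> h \<otimes> inv g" and ?k = "g \<otimes> k \<otimes> inv g"
  have "?h \<in> H" "?k \<in> K"
    using hk g H.inv_op_closed2 K.inv_op_closed2 by auto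
  moreover have "g \<otimes> x \<otimes> inv g = inv ?h \<otimes> inv ?k \<otimes> ?h \<otimes> ?k"
    using g in_carrier by (simp add: x m_assoc inv_mult_group cancel)
  ultimately show "g \<otimes> x \<otimes> inv g \<in> {inv h \<otimes> inv k \<otimes> h \<otimes> k |h k. h \<in> H \<and> k \<in> K}"
    by blast
qed

lemma (in group) normal_lower_central: "lower_central G c \<lhd> G"
proof (induction c)
  case 0
  show ?case by (simp add: normal_self)
next
  case (Suc c)
  then show ?case by (simp add: normal_commutator_subgroup normal_self)
qed

lemma group_free_nilpotent_group: "group (free_nilpotent_group r c)"
  unfolding free_nilpotent_group_def
  by (intro normal.factorgroup_is_group group.normal_lower_central group_free_group)


section \<open>Inner automorphisms and twisted conjugacy\<close>

definition inner_auto :: "('a, 'b) monoid_scheme \<Rightarrow> ('a \<Rightarrow> 'a) set" where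
  "inner_auto G = {\<lambda>x\<in>carrier G. inv\<^bsub>G\<^esub> g \<otimes>\<^bsub>G\<^esub> x \<otimes>\<^bsub>G\<^esub> g |g. g \<in> carrier G}"

definition twisted_class_one :: "('a, 'b) monoid_scheme \<Rightarrow> ('a \<Rightarrow> 'a) \<Rightarrow> 'a set" where
  "twisted_class_one G \<phi> = {inv\<^bsub>G\<^esub> z \<otimes>\<^bsub>G\<^esub> \<phi> z |z. z \<in> carrier G}"

lemma (in group) inner_auto_subset_auto: "inner_auto G \<subseteq> auto G"
proof
  fix \<phi> assume "\<phi> \<in> inner_auto G"
  then obtain g where g: "g \<in> carrier G" and \<phi>: "\<phi> = (\<lambda>x\<in>carrier G. inv g \<otimes> x \<otimes> g)"
    by (auto simp: inner_auto_def)
  have cancel: "g \<otimes> (inv g \<otimes> y) = y" "inv g \<otimes> (g \<otimes> y) = y" if "y \<in> carrier G" for y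
    using that g by (simp_all add: m_assoc[symmetric])
  have "\<phi> \<in> hom G G"
    using g by (auto simp: \<phi> hom_def m_assoc cancel)
  moreover have "bij_betw \<phi> (carrier G) (carrier G)"
    using g by (intro bij_betwI[where g = "\<lambda>x. g \<otimes> x \<otimes> inv g"])
      (auto simp: \<phi> m_assoc cancel)
  ultimately show "\<phi> \<in> auto G"
    by (auto simp: auto_def Bij_def \<phi>)
qed

end

theory Submission
  imports Defs
begin

text \<open>
  If \<open>\<phi>\<close> is conjugation by \<open>x\<close>, then the twisted class of the unit is the set of all commutators
  \<open>[z, x]\<close>. In the free nilpotent group of class 3 on \<open>x, y\<close>, put \<open>c = [y, x]\<close>. Up to powers of
  \<open>[c, x]\<close>, such a commutator has the form \<open>c\<^sup>b [c, y]\<^bsup>b(b-1)/2\<^esup>\<close>, where \<open>b\<close> is the exponent sum of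
  \<open>y\<close> in \<open>z\<close>. The second exponent depends quadratically on the first, so \<open>c\<^sup>2\<close> is not such a
  commutator although \<open>c\<close> is one, and the class is not closed under multiplication.

  This obstruction survives in a concrete group in which \<open>[c, x]\<close> becomes trivial: the
  polynomials \<open>p\<close> of degree at most 2 with integer coefficients, extended by the integers \<open>s\<close> acting through the
  translations \<open>p(n) \<mapsto> p(n + s)\<close>. It is nilpotent of class 3 because a commutator with a translation
  is a finite difference and lowers the degree. By the universal property of the free nilpotent group
  (\<open>free_nilpotent_group_universal\<close>) there is a homomorphism into it that sends \<open>x\<close> to the
  polynomial \<open>n\<^sup>2\<close> and \<open>y\<close> to the translation by 1. Under it \<open>[z, x]\<close> becomes a difference
  \<open>n\<^sup>2 - (n - s)\<^sup>2 = 2sn - s\<^sup>2\<close>, and \<open>c\<^sup>2\<close> becomes \<open>2(2n - 1) = 4n - 2\<close>. Comparing linear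
  coefficients forces \<open>s = 2\<close>, but then the constant terms \<open>-4\<close> and \<open>-2\<close> differ.
\<close>

text \<open>
  Evaluation of words is multiplicative for cancelling concatenation because the removed
  pair of mutually inverse letters evaluates to the unit.
\<close>
lemma (in group) free_group_universal:
  assumes "f \<in> X \<rightarrow> carrier G"
  shows "\<exists>h \<in> hom (free_group X) G. \<forall>x\<in>X. h [(True, x)] = f x"
proof -
  define e where "e l = (if fst l then f (snd l) else inv (f (snd l)))" for l
  define h where "h w = foldr (\<lambda>l g. e l \<otimes> g) w \<one>" for w
  have e_closed: "e l \<in> carrier G" if "snd l \<in> X" for l
    using that assms by (auto simp: e_def)
  have e_inv: "e k \<otimes> (e (inv_letter k) \<otimes> g) = g" if "snd k \<in> X" "g \<in> carrier G" for k g
    using that assms by (auto simp: e_def inv_letter_def m_assoc[symmetric] Pi_iff)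
  have h_closed: "h w \<in> carrier G" if "snd ` set w \<subseteq> X" for w
    using that by (induction w) (auto simp: h_def e_closed)
  have h_cancel: "h (cancel_Cons k w) = e k \<otimes> h w" if "snd k \<in> X" "snd ` set w \<subseteq> X" for k w
  proof (cases w)
    case (Cons l v)
    then have "h v \<in> carrier G" using that by (intro h_closed) auto
    with Cons that show ?thesis by (auto simp: h_def e_inv)
  qed (simp add: h_def)
  have h_mult: "h (foldr cancel_Cons v w) = h v \<otimes> h w"
    if "snd ` set v \<subseteq> X" "snd ` set w \<subseteq> X" for v w
    using that(1)
  proof (induction v)
    case Nil
    show ?case using h_closed[OF that(2)] by (simp add: h_def)
  next
    case (Cons k v)
    have "snd ` set (foldr cancel_Cons v w) \<subseteq> X"
      using Cons.prems that(2) by (intro subset_trans[OF letters_foldr_cancel_Cons] Un_least) simp_all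
    then have "h (foldr cancel_Cons (k # v) w) = e k \<otimes> (h v \<otimes> h w)"
      using Cons by (simp add: h_cancel)
    also have "\<dots> = (e k \<otimes> h v) \<otimes> h w"
      using Cons.prems that(2) by (intro m_assoc[symmetric] e_closed h_closed) auto
    finally show ?case by (simp add: h_def)
  qed
  show ?thesis
  proof (intro bexI ballI)
    show "h \<in> hom (free_group X) G"
      by (rule homI) (simp_all add: free_group_def h_closed h_mult)
    show "h [(True, x)] = f x" if "x \<in> X" for x
      using funcset_mem[OF assms that] by (simp add: h_def e_def)
  qed
qed

lemma (in group) lower_central_subset: "lower_central G c \<subseteq> carrier G"
  using normal_imp_subgroup[OF normal_lower_central] by (rule subgroup.subset)

lemma (in group_hom) image_lower_central:
  "h ` lower_central G c \<subseteq> lower_central H c"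
proof (induction c)
  case (Suc c)
  let ?C = "{inv x \<otimes> inv y \<otimes> x \<otimes> y |x y. x \<in> lower_central G c \<and> y \<in> carrier G}"
  let ?D = "{inv\<^bsub>H\<^esub> x \<otimes>\<^bsub>H\<^esub> inv\<^bsub>H\<^esub> y \<otimes>\<^bsub>H\<^esub> x \<otimes>\<^bsub>H\<^esub> y |x y. x \<in> lower_central H c \<and> y \<in> carrier H}"
  have lc: "x \<in> carrier G" if "x \<in> lower_central G c" for x
    using that G.lower_central_subset by blast
  have "h ` ?C \<subseteq> ?D"
  proof
    fix u assume "u \<in> h ` ?C"
    then obtain x y where xy: "x \<in> lower_central G c" "y \<in> carrier G"
      and u: "u = h (inv x \<otimes> inv y \<otimes> x \<otimes> y)" by blast
    have "u = inv\<^bsub>H\<^esub> h x \<otimes>\<^bsub>H\<^esub> inv\<^bsub>H\<^esub> h y \<otimes>\<^bsub>H\<^esub> h x \<otimes>\<^bsub>H\<^esub> h y"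
      using xy lc by (simp add: u)
    moreover have "h x \<in> lower_central H c" "h y \<in> carrier H" using xy Suc by auto
    ultimately show "u \<in> ?D" by blast
  qed
  moreover have "?C \<subseteq> carrier G" using lc by auto
  then have "h ` generate G ?C = generate H (h ` ?C)" by (rule generate_img[symmetric])
  ultimately show ?case
    by (simp add: commutator_subgroup_def mono_generate)
qed auto

text \<open>
  The homomorphism from the free group given by the images of the generators maps the lower central
  series into that of the nilpotent target, hence is constant on the cosets that make up the quotient.
\<close>
lemma (in group) free_nilpotent_group_universal:
  assumes nilpotent: "lower_central G c \<subseteq> {\<one>}" and f: "f \<in> {..<r} \<rightarrow> carrier G"
  shows "\<exists>h \<in> hom (free_nilpotent_group r c) G.
    \<forall>i<r. h (lower_central (free_group {..<r}) c #>\<^bsub>free_group {..<r}\<^esub> [(True, i)]) = f i"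
proof -
  let ?F = "free_group {..<r}" and ?L = "lower_central (free_group {..<r}) c"
  obtain h where h: "h \<in> hom ?F G" and h_gen: "\<forall>i\<in>{..<r}. h [(True, i)] = f i"
    using free_group_universal[OF f] by blast
  interpret group_hom ?F G h
    using h by (simp add: group_hom_def group_hom_axioms_def group_free_group)
  have trivial: "h l = \<one>" if "l \<in> ?L" for l
    using image_lower_central[of c] nilpotent that by blast
  have const: "h u = h v"
    if "u \<in> carrier ?F" "v \<in> carrier ?F" "?L #>\<^bsub>?F\<^esub> u = ?L #>\<^bsub>?F\<^esub> v" for u v
  proof -
    have "u \<in> ?L #>\<^bsub>?F\<^esub> v"
      using normal_imp_subgroup[OF G.normal_lower_central] that
      by (metis G.rcos_self)
    then obtain l where "l \<in> ?L" "u = l \<otimes>\<^bsub>?F\<^esub> v" by (auto simp: r_coset_def)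
    moreover have "l \<in> carrier ?F" using \<open>l \<in> ?L\<close> G.lower_central_subset by blast
    ultimately show ?thesis using that(2) by (simp add: trivial)
  qed
  have "\<exists>g\<in>hom (?F Mod ?L) G. \<forall>u\<in>carrier ?F. g (?L #>\<^bsub>?F\<^esub> u) = h u"
    by (rule FactGroup_universal[OF h G.normal_lower_central[of c]]) (blast intro: const)+
  then obtain g where "g \<in> hom (?F Mod ?L) G"
    and "\<And>u. u \<in> carrier ?F \<Longrightarrow> g (?L #>\<^bsub>?F\<^esub> u) = h u"
    by blast
  then show ?thesis
    using h_gen by (intro bexI[of _ g]) (auto simp: free_nilpotent_group_def free_group_def)
qed

lemma (in group) lower_central_Suc_subset:
  assumes "lower_central G c \<subseteq> H" and "subgroup K G"
    and "\<And>h g. h \<in> H \<Longrightarrow> g \<in> carrier G \<Longrightarrow> inv h \<otimes> inv g \<otimes> h \<otimes> g \<in> K"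
  shows "lower_central G (Suc c) \<subseteq> K"
proof -
  have "{inv h \<otimes> inv g \<otimes> h \<otimes> g |h g. h \<in> lower_central G c \<and> g \<in> carrier G} \<subseteq> K"
    using assms(1,3) by blast
  then show ?thesis
    using generate_subgroup_incl[OF _ assms(2)] by (simp add: commutator_subgroup_def)
qed

text \<open>
  The quadruple \<open>(a, b, c, s)\<close> is the map \<open>p \<mapsto> q\<close> with \<open>q(n) = an\<^sup>2 + bn + c + p(n + s)\<close>, and the
  product is composition of maps.
\<close>
definition quadratic_shift_group :: "(int \<times> int \<times> int \<times> int) monoid" where
  "quadratic_shift_group =
     \<lparr>carrier = UNIV,
      mult = (\<lambda>(a, b, c, s) (a', b', c', s').
        (a + a', b + b' + 2 * a' * s, c + c' + b' * s + a' * s * s, s + s')),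
      one = (0, 0, 0, 0)\<rparr>"

lemma quadratic_shift_group_simps [simp]:
  "carrier quadratic_shift_group = UNIV"
  "(a, b, c, s) \<otimes>\<^bsub>quadratic_shift_group\<^esub> (a', b', c', s') =
     (a + a', b + b' + 2 * a' * s, c + c' + b' * s + a' * s * s, s + s')"
  "\<one>\<^bsub>quadratic_shift_group\<^esub> = (0, 0, 0, 0)"
  by (simp_all add: quadratic_shift_group_def)

lemma group_quadratic_shift_group: "group quadratic_shift_group"
proof (rule groupI)
  fix u :: "int \<times> int \<times> int \<times> int"
  obtain a b c s where "u = (a, b, c, s)" by (cases u)
  then show "\<exists>v\<in>carrier quadratic_shift_group. v \<otimes>\<^bsub>quadratic_shift_group\<^esub> u = \<one>\<^bsub>quadratic_shift_group\<^esub>"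
    by (intro bexI[of _ "(- a, 2 * a * s - b, b * s - a * s * s - c, - s)"]) auto
qed (auto simp: algebra_simps)

interpretation Q: group quadratic_shift_group
  by (rule group_quadratic_shift_group)

lemma inv_quadratic_shift_group [simp]:
  "inv\<^bsub>quadratic_shift_group\<^esub> (a, b, c, s) = (- a, 2 * a * s - b, b * s - a * s * s - c, - s)"
  by (rule Q.inv_equality) auto

text \<open>
  The translations form an abelian quotient, so a commutator is a polynomial; it is built from finite
  differences of quadratic polynomials and hence has degree at most 1. A commutator of such a
  polynomial with any group element is again a finite difference of it, which loses one more degree.
\<close>
lemma lower_central_quadratic_shift_group:
  "lower_central quadratic_shift_group 3 \<subseteq> {\<one>\<^bsub>quadratic_shift_group\<^esub>}"
proof -
  let ?linear = "{(0, b, c, 0) |b c. True} :: (int \<times> int \<times> int \<times> int) set"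
  let ?constant = "{(0, 0, c, 0) |c. True} :: (int \<times> int \<times> int \<times> int) set"
  have "subgroup ?linear quadratic_shift_group" "subgroup ?constant quadratic_shift_group"
    by (rule Q.subgroupI; auto)+
  note sub = this Q.triv_subgroup
  have "lower_central quadratic_shift_group (Suc 0) \<subseteq> ?linear"
    by (rule Q.lower_central_Suc_subset[OF order_refl sub(1)]) auto
  then have "lower_central quadratic_shift_group (Suc (Suc 0)) \<subseteq> ?constant"
    by (rule Q.lower_central_Suc_subset[OF _ sub(2)]) auto
  then have "lower_central quadratic_shift_group (Suc (Suc (Suc 0))) \<subseteq> {\<one>\<^bsub>quadratic_shift_group\<^esub>}"
    by (rule Q.lower_central_Suc_subset[OF _ sub(3)]) auto
  then show ?thesis by (simp only: numeral_3_eq_3)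
qed

theorem proposition13:
  shows "\<exists>\<phi> \<in> inner_auto (free_nilpotent_group 2 3).
           \<not> subgroup (twisted_class_one (free_nilpotent_group 2 3) \<phi>) (free_nilpotent_group 2 3)"
proof -
  let ?N = "free_nilpotent_group 2 3" and ?F = "free_group {..<2::nat}"
  define gen where "gen i = lower_central ?F 3 #>\<^bsub>?F\<^esub> [(True, i)]" for i
  define x where "x = gen 0"
  define y where "y = gen 1"
  define f :: "nat \<Rightarrow> int \<times> int \<times> int \<times> int"
    where "f i = (if i = 0 then (1, 0, 0, 0) else (0, 0, 0, 1))" for i
  obtain h where h: "h \<in> hom ?N quadratic_shift_group" and "\<forall>i<2. h (gen i) = f i"
    using Q.free_nilpotent_group_universal[OF lower_central_quadratic_shift_group, of f 2]
    by (auto simp: gen_def)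
  then have hx: "h x = (1, 0, 0, 0)" and hy: "h y = (0, 0, 0, 1)"
    by (simp_all add: x_def y_def f_def)
  interpret group_hom ?N quadratic_shift_group h
    using h by (simp add: group_hom_def group_hom_axioms_def group_free_nilpotent_group Q.is_group)
  have "gen i \<in> carrier ?N" if "i < 2" for i
  proof -
    have "[(True, i)] \<in> carrier ?F" using that by (simp add: free_group_def)
    then show ?thesis
      by (auto simp: gen_def free_nilpotent_group_def FactGroup_def RCOSETS_def)
  qed
  then have x: "x \<in> carrier ?N" and y: "y \<in> carrier ?N"
    by (simp_all add: x_def y_def)
  define \<phi> where "\<phi> = (\<lambda>z\<in>carrier ?N. inv\<^bsub>?N\<^esub> x \<otimes>\<^bsub>?N\<^esub> z \<otimes>\<^bsub>?N\<^esub> x)"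
  let ?T = "twisted_class_one ?N \<phi>" and ?d = "inv\<^bsub>?N\<^esub> y \<otimes>\<^bsub>?N\<^esub> \<phi> y"
  \<comment> \<open>Every commutator with \<open>x\<close> maps to a difference \<open>n\<^sup>2 - (n - s)\<^sup>2\<close>.\<close>
  have difference: "\<exists>s. h t = (0, 2 * s, - (s * s), 0)" if t_class: "t \<in> ?T" for t
  proof -
    obtain z where z: "z \<in> carrier ?N" and t: "t = inv\<^bsub>?N\<^esub> z \<otimes>\<^bsub>?N\<^esub> \<phi> z"
      using t_class by (auto simp: twisted_class_one_def)
    obtain a b c s where hz: "h z = (a, b, c, s)" by (cases "h z")
    have "h t = (0, 2 * s, - (s * s), 0)"
      using z x by (simp add: t \<phi>_def hz hx algebra_simps)
    then show ?thesis ..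
  qed
  have "\<not> subgroup ?T ?N"
  proof
    assume T: "subgroup ?T ?N"
    have "?d \<in> ?T" using y by (auto simp: twisted_class_one_def)
    then have "?d \<otimes>\<^bsub>?N\<^esub> ?d \<in> ?T" using T by (blast intro: subgroup.m_closed)
    then obtain s where "h (?d \<otimes>\<^bsub>?N\<^esub> ?d) = (0, 2 * s, - (s * s), 0)" using difference by blast
    moreover have "h (?d \<otimes>\<^bsub>?N\<^esub> ?d) = (0, 4, - 2, 0)"
      using x y by (simp add: \<phi>_def hx hy)
    ultimately show False by auto
  qed
  moreover have "\<phi> \<in> inner_auto ?N"
    using x by (auto simp: \<phi>_def inner_auto_def)
  ultimately show ?thesis by blast
qed

end
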